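(* For a positive integer $n$, let $\mathcal{P}(n)$ denote the power set of $[n]=\{1,\dots,n\}$, and let $\alpha(n)$ be the number of union-free families $\mathcal{F}\subseteq \mathcal{P}(n)$. Then $$\alpha(n)=2^{\binom{n}{\lfloor n/2\rfloor}(1+o(1))}\qquad (n\to\infty).$$
   Context: A family $\mathcal{F}\subseteq\mathcal{P}(n)$ is union-free if there are no three distinct sets $A,B,C\in\mathcal{F}$ with $A\cup B=C$. *)

theory Defs
  imports Complex_Main "HOL-Library.Landau_Symbols"
begin

definition union_free :: "'a set set \<Rightarrow> bool" where
  "union_free F \<longleftrightarrow>
     \<not> (\<exists>A\<in>F. \<exists>B\<in>F. \<exists>C\<in>F. A \<noteq> B \<and> A \<noteq> C \<and> B \<noteq> C \<and> A \<union> B = C)"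

definition num_union_free :: "nat \<Rightarrow> nat" where
  "num_union_free n = card {F. F \<subseteq> Pow {1..n} \<and> union_free F}"

end

theory Submission
  imports Defs "HOL-Combinatorics.Multiset_Permutations" "HOL-Real_Asymp.Real_Asymp"
begin

text \<open>
  Subfamilies of the middle layer are union-free, which gives the lower bound. For the upper bound
  let \<open>G\<close> be a family of sets close to the middle layer with more than \<open>(1 + \<delta>) * (n choose n div 2)\<close>
  members. By an LYM argument some \<open>C \<in> G\<close> is such that a random chain descending from \<open>C\<close> meets
  \<open>G\<close> again with probability bounded below. Cutting a random permutation of \<open>C\<close> into boundedly
  many blocks, with positive probability two of the chains that remove initial segments of a block
  meet \<open>G\<close>; the two sets found have union \<open>C\<close>. Hence linearly many \<open>B \<in> G\<close> below \<open>C\<close> each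
  satisfy \<open>A \<union> B = C\<close> for linearly many \<open>A \<in> G\<close>. Branching on whether \<open>C\<close> and such a \<open>B\<close> belong to
  a union-free family then discards linearly many sets for two recorded ones, so the branching
  contributes a factor of only \<open>2 ^ o(n choose n div 2)\<close> until at most
  \<open>(1 + \<delta>) * (n choose n div 2)\<close> sets are left. The sets far from the middle are negligible by
  Chebyshev's inequality.
\<close>

section \<open>Random permutations and chains\<close>

lemma permutations_of_set_append:
  assumes "S \<subseteq> A" "xs \<in> permutations_of_set S" "ys \<in> permutations_of_set (A - S)"
  shows "xs @ ys \<in> permutations_of_set A"
  using assms by (auto simp: permutations_of_set_def)

lemma permutations_of_set_split:
  assumes "xs \<in> permutations_of_set A"
  shows "take j xs \<in> permutations_of_set (set (take j xs))"
    and "drop j xs \<in> permutations_of_set (A - set (take j xs))"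
    and "set (drop j xs) = A - set (take j xs)"
proof -
  have xs: "set xs = A" "distinct xs"
    using assms by (auto simp: permutations_of_set_def)
  have "set (take j xs) \<union> set (drop j xs) = A"
    using xs by (metis append_take_drop_id set_append)
  moreover have "set (take j xs) \<inter> set (drop j xs) = {}"
    using xs by (simp add: set_take_disj_set_drop_if_distinct)
  ultimately show 3: "set (drop j xs) = A - set (take j xs)" by blast
  show "take j xs \<in> permutations_of_set (set (take j xs))"
    using xs by (auto simp: permutations_of_set_def)
  show "drop j xs \<in> permutations_of_set (A - set (take j xs))"
    using xs 3 by (auto simp: permutations_of_set_def)
qed

text \<open>Lets any later block of a uniformly random permutation be moved to the front, so that
  every block is distributed like the first one.\<close>

lemma rotate_permutations_of_set:
  "bij_betw (rotate l) (permutations_of_set A) (permutations_of_set A)"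
proof -
  have inj: "inj (rotate l)"
    unfolding rotate_def using inj_rotate1 by (rule inj_fn)
  have surj: "surj (rotate l)"
    unfolding rotate_def using surj_rotate1 by (rule surj_fn)
  have "rotate l ` permutations_of_set A = permutations_of_set A"
  proof
    show "rotate l ` permutations_of_set A \<subseteq> permutations_of_set A"
      by (auto simp: permutations_of_set_def)
    show "permutations_of_set A \<subseteq> rotate l ` permutations_of_set A"
    proof
      fix xs assume "xs \<in> permutations_of_set A"
      moreover obtain ys where "xs = rotate l ys" using surj by (metis surjD)
      ultimately show "xs \<in> rotate l ` permutations_of_set A"
        by (auto simp: permutations_of_set_def)
    qed
  qed
  with inj show ?thesis unfolding bij_betw_def by (blast intro: inj_on_subset)
qed

text \<open>Equivalent to \<open>s + t \<le> (s + t choose s)\<close>, the form in which it bounds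
  probabilities of prefixes below.\<close>

lemma fact_mult_fact_le:
  fixes s t :: nat
  assumes "0 < s" "0 < t"
  shows "fact s * fact t \<le> (fact (s + t - 1) :: nat)"
  using assms(1)
proof (induction s rule: nat_induct_non_zero)
  case (Suc s)
  obtain u where u: "s + t = Suc u" using Suc by (cases "s + t") auto
  have "fact (Suc s) * fact t = Suc s * (fact s * fact t :: nat)" by (simp add: algebra_simps)
  also have "\<dots> \<le> Suc u * fact u"
    using Suc u assms(2) by (intro mult_mono) auto
  also have "\<dots> = fact (Suc s + t - 1)" using u by simp
  finally show ?case .
qed (use assms in simp)

text \<open>Such a list is an ordering of \<open>S\<close> followed by one of \<open>A - S\<close>;
  hence a prescribed nonempty proper subset is a prefix with probability at most
  \<open>1 / card A\<close>.\<close>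

lemma card_permutations_with_prefix_le:
  assumes A: "finite A" and S: "0 < card S" "card S < card A"
  shows "card {xs \<in> permutations_of_set A. set (take (card S) xs) = S} \<le> fact (card A - 1)"
proof (cases "S \<subseteq> A")
  case True
  let ?P = "{xs \<in> permutations_of_set A. set (take (card S) xs) = S}"
  let ?Q = "permutations_of_set S \<times> permutations_of_set (A - S)"
  have fS: "finite S" using True A by (rule finite_subset)
  have "?P \<subseteq> (\<lambda>(us, vs). us @ vs) ` ?Q"
  proof
    fix xs assume "xs \<in> ?P"
    then have "(take (card S) xs, drop (card S) xs) \<in> ?Q"
      using permutations_of_set_split[of xs A "card S"] by auto
    then show "xs \<in> (\<lambda>(us, vs). us @ vs) ` ?Q"
      by (metis (mono_tags, lifting) append_take_drop_id case_prod_conv image_eqI)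
  qed
  then have "card ?P \<le> card ?Q" by (intro surj_card_le) auto
  also have "\<dots> = fact (card S) * fact (card A - card S)"
    using A fS True by (simp add: card_cartesian_product card_Diff_subset)
  also have "\<dots> \<le> fact (card A - 1)"
    using fact_mult_fact_le[of "card S" "card A - card S"] S by simp
  finally show ?thesis .
next
  case False
  then have "{xs \<in> permutations_of_set A. set (take (card S) xs) = S} = {}"
    by (auto simp: permutations_of_set_def dest: in_set_takeD)
  then show ?thesis by (simp only: card.empty)
qed

text \<open>Union bound over \<open>T\<close> alone: the size of a prefix set fixes its length.
  Values of \<open>j\<close> beyond the length give all of \<open>A\<close>, which the size
  condition on \<open>T\<close> excludes.\<close>

lemma card_permutations_prefix_in_le:
  assumes A: "finite A" and T: "finite T" and S: "\<And>S. S \<in> T \<Longrightarrow> 0 < card S \<and> card S < card A"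
  shows "card {xs \<in> permutations_of_set A. \<exists>j. set (take j xs) \<in> T} \<le> card T * fact (card A - 1)"
proof -
  have "{xs \<in> permutations_of_set A. \<exists>j. set (take j xs) \<in> T}
      \<subseteq> (\<Union>S\<in>T. {xs \<in> permutations_of_set A. set (take (card S) xs) = S})"
  proof clarsimp
    fix xs j assume xs: "xs \<in> permutations_of_set A" and j: "set (take j xs) \<in> T"
    have d: "distinct xs" "length xs = card A"
      using xs by (auto simp: permutations_of_set_def distinct_card)
    have c: "card (set (take j xs)) = min j (card A)"
      using d by (simp add: distinct_card min.commute)
    then have "take (card (set (take j xs))) xs = take j xs"
      using d S[OF j] by (auto simp: min_def split: if_splits)
    then show "\<exists>S\<in>T. set (take (card S) xs) = S" using j by metis
  qed
  then have "card {xs \<in> permutations_of_set A. \<exists>j. set (take j xs) \<in> T}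
      \<le> card (\<Union>S\<in>T. {xs \<in> permutations_of_set A. set (take (card S) xs) = S})"
    using T by (intro card_mono) auto
  also have "\<dots> \<le> (\<Sum>S\<in>T. card {xs \<in> permutations_of_set A. set (take (card S) xs) = S})"
    by (rule card_UN_le[OF T])
  also have "\<dots> \<le> (\<Sum>S\<in>T. fact (card A - 1))"
    using card_permutations_with_prefix_le[OF A] S by (intro sum_mono) auto
  finally show ?thesis by simp
qed

text \<open>Chains are sequences of suffixes of permutations; each chain is charged to the smallest
  member of \<open>G\<close> on it.\<close>
lemma card_le_central_binomial_of_few_hits:
  fixes X :: "'a set" and \<eta> :: real
  assumes X: "finite X" and G: "G \<subseteq> Pow X" 
    and hits: "\<And>C. C \<in> G \<Longrightarrow>
      real (card {ys \<in> permutations_of_set C. \<exists>j\<in>{1..card C}. set (drop j ys) \<in> G}) \<le> \<eta> * fact (card C)"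
  shows "(1 - \<eta>) * card G \<le> (card X choose (card X div 2))"
proof -
  define n where "n = card X"
  \<comment> \<open>The index \<open>j = card C\<close> makes the empty set count as a possible
    later hit. Putting an ordering of \<open>X - C\<close> in front of a list in
    \<open>last C\<close> gives, in \<open>E C\<close>, the chains of \<open>X\<close> whose
    smallest member in \<open>G\<close> is \<open>C\<close>.\<close>
  define last where "last C = {ys \<in> permutations_of_set C. \<forall>j\<in>{1..card C}. set (drop j ys) \<notin> G}" for C
  define E where "E C = (\<lambda>(zs, ys). zs @ ys) ` (permutations_of_set (X - C) \<times> last C)" for C
  have finC: "finite C" if "C \<in> G" for C using that G X by (meson PowD finite_subset in_mono)
  have finG: "finite G" using G X by (simp add: finite_subset)
  have finlast: "finite (last C)" for C by (simp add: last_def)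
  have inj: "inj_on (\<lambda>(zs, ys). zs @ ys) (permutations_of_set (X - C) \<times> last C)" for C
    by (auto simp: inj_on_def permutations_of_set_def last_def)
       (metis append_eq_append_conv distinct_card)+
  have cardE: "card (E C) = fact (n - card C) * card (last C)" if "C \<in> G" for C
  proof -
    have "card (X - C) = n - card C"
      using that G X finC by (auto simp: n_def card_Diff_subset)
    then show ?thesis
      unfolding E_def using inj X by (simp add: card_image card_cartesian_product)
  qed
  have cardlast: "(1 - \<eta>) * fact (card C) \<le> card (last C)" if "C \<in> G" for C
  proof -
    let ?H = "{ys \<in> permutations_of_set C. \<exists>j\<in>{1..card C}. set (drop j ys) \<in> G}"
    have "last C = permutations_of_set C - ?H" by (auto simp: last_def)
    then have "card (last C) = card (permutations_of_set C) - card ?H"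
      by (simp add: card_Diff_subset)
    moreover have "card ?H \<le> card (permutations_of_set C)" by (intro card_mono) auto
    ultimately show ?thesis using hits[OF that] finC[OF that]
      by (simp add: of_nat_diff algebra_simps)
  qed
  have Esub: "E C \<subseteq> permutations_of_set X" if "C \<in> G" for C
    using that G permutations_of_set_append[of "X - C" X] by (auto simp: E_def last_def double_diff)
  \<comment> \<open>In a common list the shorter of the two suffixes is a \<open>drop j\<close> of
    the longer one: \<open>j = 0\<close> forces \<open>C = C'\<close>, and \<open>j > 0\<close> is a
    hit that \<open>last C\<close> forbids.\<close>
  have disj: "E C \<inter> E C' = {}" if "C \<in> G" "C' \<in> G" "C \<noteq> C'" "card C' \<le> card C" for C C'
  proof (rule ccontr)
    assume "E C \<inter> E C' \<noteq> {}"
    then obtain zs ys zs' ys' where *: "zs @ ys = zs' @ ys'" "ys \<in> last C" "ys' \<in> last C'"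
      by (auto simp: E_def)
    have l: "length ys = card C" "length ys' = card C'" "set ys' = C'" "set ys = C"
      using * by (auto simp: last_def permutations_of_set_def distinct_card)
    have "length zs + length ys = length zs' + length ys'" using *(1) by (metis length_append)
    then have lz: "length zs \<le> length zs'" using l that by simp
    define j where "j = length zs' - length zs"
    have ys': "ys' = drop j ys"
    proof -
      have "ys' = drop (length zs') (zs @ ys)" by (simp add: *(1))
      also have "\<dots> = drop j ys" using lz by (simp add: j_def)
      finally show ?thesis .
    qed
    show False
    proof (cases "j = 0")
      case True
      then show False using ys' l that by simp
    next
      case False
      have "j \<le> card C" using l \<open>length zs + length ys = _\<close> lz by (simp add: j_def)
      then have "set (drop j ys) \<notin> G" using *(2) False by (auto simp: last_def)
      then show False using ys' l that by simp
    qed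
  qed
  have disjoint: "\<forall>C\<in>G. \<forall>C'\<in>G. C \<noteq> C' \<longrightarrow> E C \<inter> E C' = {}"
    using disj by (metis inf_commute nle_le)
  have finE: "finite (E C)" for C by (simp add: E_def finlast)
  have "(\<Sum>C\<in>G. card (E C)) = card (\<Union>C\<in>G. E C)"
    by (rule card_UN_disjoint[OF finG _ disjoint, symmetric]) (simp add: finE)
  also have "\<dots> \<le> card (permutations_of_set X)"
    using Esub by (intro card_mono) auto
  also have "\<dots> = fact n" using X by (simp add: n_def)
  finally have le: "(\<Sum>C\<in>G. card (E C)) \<le> fact n" .
  show ?thesis
  \<comment> \<open>With \<open>\<eta> \<le> 1\<close> the LYM weights apply: a chain passes through
    \<open>C\<close> with probability \<open>1 / (n choose card C)\<close>, which is least at the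
    middle layer. With \<open>\<eta> > 1\<close> the left side is nonpositive.\<close>
  proof (cases "\<eta> \<le> 1")
    case True
    have "(1 - \<eta>) * fact n / (n choose (n div 2)) \<le> card (E C)" if C: "C \<in> G" for C
    proof -
      have cn: "card C \<le> n" using C G X by (auto simp: n_def intro: card_mono)
      have "fact n = fact (card C) * fact (n - card C) * (n choose card C)"
        using binomial_fact_lemma[OF cn] by simp
      also have "\<dots> \<le> fact (card C) * fact (n - card C) * (n choose (n div 2))"
        by (intro mult_mono binomial_maximum) auto
      finally have "real (fact n) \<le> real (fact (card C) * fact (n - card C) * (n choose (n div 2)))"
        unfolding of_nat_le_iff .
      then have "fact n / (n choose (n div 2)) \<le> fact (card C) * (fact (n - card C) :: real)"
        by (simp add: divide_le_eq)
      then have "(1 - \<eta>) * (fact n / (n choose (n div 2))) \<le> (1 - \<eta>) * (fact (card C) * fact (n - card C))"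
        using True by (intro mult_left_mono) auto
      also have "\<dots> \<le> card (last C) * fact (n - card C)"
        using mult_right_mono[OF cardlast[OF C], of "fact (n - card C)"] by (simp add: mult_ac)
      finally show ?thesis using cardE[OF C] by (simp add: mult.commute)
    qed
    then have "(\<Sum>C\<in>G. (1 - \<eta>) * fact n / (n choose (n div 2))) \<le> (\<Sum>C\<in>G. real (card (E C)))"
      by (intro sum_mono)
    also have "\<dots> \<le> fact n" using le by (metis of_nat_fact of_nat_le_iff of_nat_sum)
    finally have "(1 - \<eta>) * card G * fact n \<le> (n choose (n div 2)) * fact n"
      by (simp add: divide_le_eq mult_ac)
    then show ?thesis by (simp add: n_def)
  next
    case False
    then have "(1 - \<eta>) * card G \<le> 0" by (intro mult_nonpos_nonneg) auto
    then show ?thesis by (meson of_nat_0_le_iff order_trans)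
  qed
qed

section \<open>Simultaneous hits in two blocks of a random permutation\<close>

lemma card_permutations_rotate:
  "card {ys \<in> permutations_of_set A. Q (rotate l ys)} = card {ys \<in> permutations_of_set A. Q ys}"
proof (rule bij_betw_same_card)
  show "bij_betw (rotate l) {ys \<in> permutations_of_set A. Q (rotate l ys)} {ys \<in> permutations_of_set A. Q ys}"
    using rotate_permutations_of_set[of l A]
    unfolding bij_betw_def by (auto simp: inj_on_def image_iff) 
qed

lemma take_rotate:
  assumes "j + l \<le> length xs"
  shows "take j (rotate l xs) = take j (drop l xs)"
proof (cases "l = length xs")
  case False
  then have "l mod length xs = l" using assms by simp
  then show ?thesis using assms by (simp add: rotate_drop_take)
qed (use assms in simp)

lemma sum_card_swap:
  assumes "finite A" "finite B"
  shows "(\<Sum>x\<in>A. card {y \<in> B. R x y}) = (\<Sum>y\<in>B. card {x \<in> A. R x y})"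
  using sum.swap_restrict[OF assms, of "\<lambda>_ _. 1::nat" R] by simp

text \<open>Pairing the first hit with each later one already gives enough pairs. This turns a lower
  bound on the expected number of hits into one on the expected number of pairs of hits.\<close>

lemma card_pairs_ge:
  fixes R :: "nat \<Rightarrow> bool"
  shows "card {i \<in> {..<r}. R i} \<le> card {(i, j). i < j \<and> j < r \<and> R i \<and> R j} + 1"
proof (cases "{i \<in> {..<r}. R i} = {}")
  case False
  define H where "H = {i \<in> {..<r}. R i}"
  have H: "finite H" "H \<noteq> {}" using False by (auto simp: H_def)
  have m: "Min H \<in> H" "\<And>i. i \<in> H \<Longrightarrow> Min H \<le> i" using H by auto
  have fin: "finite {(i, j). i < j \<and> j < r \<and> R i \<and> R j}"
    by (rule finite_subset[of _ "{..<r} \<times> {..<r}"]) auto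
  have "Pair (Min H) ` (H - {Min H}) \<subseteq> {(i, j). i < j \<and> j < r \<and> R i \<and> R j}"
    using m by (force simp: H_def le_less)
  then have "card (H - {Min H}) \<le> card {(i, j). i < j \<and> j < r \<and> R i \<and> R j}"
    using fin by (intro card_inj_on_le[where f = "Pair (Min H)"]) (auto simp: inj_on_def)
  then show ?thesis using H m unfolding H_def[symmetric] by (simp add: card_Diff_singleton)
qed (auto simp only: card.empty)

lemma card_take_permutation:
  assumes "ys \<in> permutations_of_set C"
  shows "card (set (take j ys)) = min j (card C)"
  using assms by (auto simp: permutations_of_set_def distinct_card min.commute)

text \<open>Two disjoint blocks of a random permutation of \<open>C\<close>: after fixing the first block, which
  starts with a set \<open>S\<close> disjoint from fewer than \<open>D\<close> members of \<open>\<S>\<close>, the other block is still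
  uniform, so it starts with one of these members with probability less than \<open>D / (k - m)\<close>.\<close>
lemma card_permutations_two_blocks_le:
  fixes C :: "'a set" and \<S> :: "'a set set" and D :: nat
  assumes C: "finite C" and \<S>: "\<S> \<subseteq> Pow C" "\<And>S. S \<in> \<S> \<Longrightarrow> 0 < card S \<and> card S \<le> m"
    and d: "0 < d" "(d + 1) * m \<le> card C" and m: "2 * m < card C" "0 < m"
  defines "H \<equiv> {S \<in> \<S>. D \<le> card {S' \<in> \<S>. S \<inter> S' = {}}}"
  shows "(card C - m) * card {ys \<in> permutations_of_set C. (\<exists>j. set (take j ys) \<in> \<S>) \<and>
           (\<exists>j. set (take j (rotate (d * m) ys)) \<in> \<S>)} \<le> (card H + D) * fact (card C)"
proof -
  define k where "k = card C"
  define P where "P = permutations_of_set C"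
  \<comment> \<open>Offset of the second block once the first \<open>m\<close> entries have been
    removed.\<close>
  define b where "b = (d - 1) * m"
  have bm: "b + m = d * m" using d by (cases d) (auto simp: b_def)
  have bk: "d * m + m \<le> k" using d by (simp add: k_def)
  have fin\<S>: "finite \<S>" using \<S> C by (simp add: finite_subset)
  have finH: "finite H" using fin\<S> by (simp add: H_def)
  have short: "j \<le> m" if "ys \<in> P" "set (take j ys) \<in> \<S>" for ys j
    using \<S>(2)[OF that(2)] card_take_permutation[of ys C j] that m by (auto simp: P_def min_def split: if_splits)
  \<comment> \<open>The chosen prefix set depends on the first block \<open>w\<close> only, so the
    remaining entries stay uniform when \<open>w\<close> is fixed.\<close>
  define f where "f w = (SOME S. S \<in> \<S> - H \<and> (\<exists>j. S = set (take j w)))" for w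
  define W where "W = take m ` {ys \<in> P. \<exists>j. set (take j ys) \<in> \<S> - H}"
  define nb where "nb w = {S' \<in> \<S>. f w \<inter> S' = {}}" for w
  define R where "R w = {zs \<in> permutations_of_set (C - set w). \<exists>j. set (take j (rotate b zs)) \<in> nb w}" for w
  \<comment> \<open>Either the first block starts with a member of \<open>H\<close>, which costs
    \<open>card H / k\<close> by the union bound, or it starts with a member outside
    \<open>H\<close>, and then the second block has fewer than \<open>D\<close> admissible
    sets.\<close>
  define B1 where "B1 = {ys \<in> P. \<exists>j. set (take j ys) \<in> H}"
  define B2 where "B2 = {ys \<in> P. (\<exists>j. set (take j ys) \<in> \<S> - H) \<and> (\<exists>j. set (take j (rotate (d * m) ys)) \<in> \<S>)}"
  have finP: "finite P" by (simp add: P_def)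
  have finW: "finite W" using finP by (simp add: W_def)
  have W: "length w = m" "distinct w" "set w \<subseteq> C" "card (C - set w) = k - m" "f w \<in> \<S> - H" "f w \<subseteq> set w"
    if wW: "w \<in> W" for w
  proof -
    obtain ys j where ys: "ys \<in> P" "set (take j ys) \<in> \<S> - H" "w = take m ys"
      using wW unfolding W_def by blast
    have y: "set ys = C" "distinct ys" "length ys = k"
      using ys(1) by (auto simp: P_def permutations_of_set_def k_def distinct_card)
    show 1: "length w = m" "distinct w" "set w \<subseteq> C" using y ys(3) m set_take_subset[of m ys]
      by (auto simp: k_def)
    then show "card (C - set w) = k - m" using C by (simp add: card_Diff_subset k_def distinct_card)
    have "j \<le> m" using short ys by blast
    then have "set (take j ys) = set (take j w)" using ys(3) by (simp add: min_def)
    then have "\<exists>S. S \<in> \<S> - H \<and> (\<exists>j. S = set (take j w))" using ys(2) by metis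
    then have *: "f w \<in> \<S> - H \<and> (\<exists>j. f w = set (take j w))"
      unfolding f_def by (rule someI_ex)
    then show "f w \<in> \<S> - H" by blast
    show "f w \<subseteq> set w" using * by (metis set_take_subset)
  qed
  have "card B1 \<le> card H * fact (k - 1)"
    unfolding B1_def P_def k_def
    using \<S> m by (intro card_permutations_prefix_in_le C finH) (auto simp: H_def dest!: \<S>(2))
  then have "(k - m) * card B1 \<le> k * (card H * fact (k - 1))" by (intro mult_mono) auto
  also have "\<dots> = card H * fact k" using m by (subst (2) fact_reduce) (auto simp: k_def)
  finally have B1: "(k - m) * card B1 \<le> card H * fact k" .
  have R: "card (R w) \<le> D * fact (k - m - 1)" if "w \<in> W" for w
  proof -
    have "card (nb w) \<le> D" using W(5)[OF that] by (auto simp: H_def nb_def)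
    have "card (R w) = card {zs \<in> permutations_of_set (C - set w). \<exists>j. set (take j zs) \<in> nb w}"
      unfolding R_def by (rule card_permutations_rotate)
    also have "\<dots> \<le> card (nb w) * fact (card (C - set w) - 1)"
      using fin\<S> C m W(4)[OF that]
      by (intro card_permutations_prefix_in_le) (auto simp: nb_def k_def dest!: \<S>(2))
    also have "\<dots> \<le> D * fact (k - m - 1)"
      using \<open>card (nb w) \<le> D\<close> W(4)[OF that] by (simp add: mult_right_mono)
    finally show ?thesis .
  qed
  have "B2 \<subseteq> (\<lambda>(w, zs). w @ zs) ` (SIGMA w:W. R w)"
  proof
    fix ys assume ys: "ys \<in> B2"
    then have ysP: "ys \<in> P" by (simp add: B2_def)
    then have y: "set ys = C" "distinct ys" "length ys = k"
      by (auto simp: P_def permutations_of_set_def k_def distinct_card)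
    have w: "take m ys \<in> W" using ys by (auto simp: W_def B2_def)
    obtain j where j: "set (take j (rotate (d * m) ys)) \<in> \<S>" using ys by (auto simp: B2_def)
    have "rotate (d * m) ys \<in> P" using ysP by (auto simp: P_def permutations_of_set_def)
    then have "j \<le> m" using short j by blast
    then have 1: "take j (rotate (d * m) ys) = take j (drop (d * m) ys)"
      using bk y by (intro take_rotate) simp
    have 2: "take j (rotate b (drop m ys)) = take j (drop b (drop m ys))"
      using bk bm y \<open>j \<le> m\<close> by (intro take_rotate) simp
    have eq: "take j (rotate b (drop m ys)) = take j (rotate (d * m) ys)"
      unfolding 1 2 by (simp add: bm)
    \<comment> \<open>The second hit uses entries after position \<open>m\<close> and
      \<open>f\<close> of the first block uses entries before it, so distinctness of the list makes
      the two sets disjoint.\<close>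
    have "set (take j (rotate b (drop m ys))) \<subseteq> set (drop m ys)"
      by (metis set_rotate set_take_subset)
    then have "f (take m ys) \<inter> set (take j (rotate b (drop m ys))) = {}"
      using W(6)[OF w] set_take_disj_set_drop_if_distinct[of ys m m] y by fastforce
    then have "set (take j (rotate b (drop m ys))) \<in> nb (take m ys)"
      using j eq by (simp add: nb_def)
    moreover have "drop m ys \<in> permutations_of_set (C - set (take m ys))"
      using permutations_of_set_split(2)[of ys C m] ysP by (simp add: P_def)
    ultimately have "drop m ys \<in> R (take m ys)" by (auto simp: R_def)
    then have "(take m ys, drop m ys) \<in> (SIGMA w:W. R w)" using w by simp
    then show "ys \<in> (\<lambda>(w, zs). w @ zs) ` (SIGMA w:W. R w)"
      by (metis (mono_tags, lifting) append_take_drop_id case_prod_conv image_eqI)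
  qed
  then have "card B2 \<le> card (SIGMA w:W. R w)"
    using finW by (intro surj_card_le) (auto simp: R_def)
  also have "\<dots> = (\<Sum>w\<in>W. card (R w))"
    using finW by (intro card_SigmaI) (auto simp: R_def)
  also have "\<dots> \<le> card W * (D * fact (k - m - 1))"
    using sum_bounded_above[of W "\<lambda>w. card (R w)"] R by simp
  finally have "(k - m) * card B2 \<le> (k - m) * (card W * (D * fact (k - m - 1)))"
    by (rule mult_left_mono) simp
  also have "\<dots> = D * (card W * fact (k - m))"
    using m by (subst (2) fact_reduce) (auto simp: k_def)
  also have "card W * fact (k - m) \<le> fact k"
  proof -
    \<comment> \<open>All blocks in \<open>W\<close> have the same length \<open>m\<close>, so a
      concatenation can be split in only one way.\<close>
    have inj: "inj_on (\<lambda>(w, zs). w @ zs) (SIGMA w:W. permutations_of_set (C - set w))"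
      using W(1) by (auto simp: inj_on_def)
    have "card W * fact (k - m) = (\<Sum>w\<in>W. card (permutations_of_set (C - set w)))"
      using W(4) C by simp
    also have "\<dots> = card (SIGMA w:W. permutations_of_set (C - set w))"
      using finW by (intro card_SigmaI[symmetric]) auto
    also have "\<dots> = card ((\<lambda>(w, zs). w @ zs) ` (SIGMA w:W. permutations_of_set (C - set w)))"
      using inj by (simp add: card_image)
    also have "\<dots> \<le> card P"
    proof (intro card_mono finP, clarify)
      fix w zs assume "w \<in> W" "zs \<in> permutations_of_set (C - set w)"
      then show "w @ zs \<in> P"
        unfolding P_def using W[of w] by (intro permutations_of_set_append[of "set w"]) auto
    qed
    also have "\<dots> = fact k" using C by (simp add: P_def k_def)
    finally show ?thesis .
  qed
  finally have B2: "(k - m) * card B2 \<le> D * fact k" by simp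
  have "{ys \<in> P. (\<exists>j. set (take j ys) \<in> \<S>) \<and> (\<exists>j. set (take j (rotate (d * m) ys)) \<in> \<S>)} \<subseteq> B1 \<union> B2"
    by (auto simp: B1_def B2_def)
  then have "card {ys \<in> P. (\<exists>j. set (take j ys) \<in> \<S>) \<and> (\<exists>j. set (take j (rotate (d * m) ys)) \<in> \<S>)} \<le> card (B1 \<union> B2)"
    using finP by (intro card_mono) (auto simp: B1_def B2_def)
  also have "\<dots> \<le> card B1 + card B2" by (rule card_Un_le)
  finally have "(k - m) * card {ys \<in> P. (\<exists>j. set (take j ys) \<in> \<S>) \<and> (\<exists>j. set (take j (rotate (d * m) ys)) \<in> \<S>)}
      \<le> (k - m) * (card B1 + card B2)" by (rule mult_left_mono) simp
  also have "\<dots> \<le> (card H + D) * fact k" using B1 B2 by (simp add: algebra_simps)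
  finally show ?thesis by (simp add: k_def P_def)
qed

text \<open>Cut a random permutation into \<open>r\<close> blocks of length \<open>m\<close>. Each
  is hit with probability at least \<open>2 / r\<close>, so the expected number of pairs of hit
  blocks is at least 1. If the conclusion failed, each of at most \<open>r\<^sup>2\<close> pairs
  would be hit with probability at most \<open>2 * D / (card C - m)\<close>, too little by the bound
  on \<open>D\<close>.\<close>

lemma many_disjoint_pairs:
  fixes C :: "'a set" and \<S> :: "'a set set" and D :: nat
  assumes C: "finite C" and \<S>: "\<S> \<subseteq> Pow C" "\<And>S. S \<in> \<S> \<Longrightarrow> 0 < card S \<and> card S \<le> m"
    and r: "3 \<le> r" "r * m \<le> card C" and D: "2 * r\<^sup>2 * D < card C - m"
    and hits: "2 * fact (card C) \<le> r * card {ys \<in> permutations_of_set C. \<exists>j. set (take j ys) \<in> \<S>}"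
  shows "D \<le> card {S \<in> \<S>. D \<le> card {S' \<in> \<S>. S \<inter> S' = {}}}"
proof (rule ccontr)
  define H where "H = {S \<in> \<S>. D \<le> card {S' \<in> \<S>. S \<inter> S' = {}}}"
  assume "\<not> ?thesis"
  then have HD: "card H \<le> D" by (simp add: H_def)
  define k where "k = card C"
  define P where "P = permutations_of_set C"
  define ev where "ev i ys \<longleftrightarrow> (\<exists>j. set (take j (rotate (i * m) ys)) \<in> \<S>)" for i ys
  define I where "I = {(i, j). i < j \<and> j < r}"
  have finI: "finite I" and cardI: "card I \<le> r\<^sup>2"
  proof -
    have *: "I \<subseteq> {..<r} \<times> {..<r}" by (auto simp: I_def)
    show "finite I" by (rule finite_subset[OF *]) simp
    show "card I \<le> r\<^sup>2" using card_mono[OF _ *] by (simp add: card_cartesian_product power2_eq_square)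
  qed
  have finP: "finite P" and cardP: "card P = fact k" using C by (auto simp: P_def k_def)
  have "{ys \<in> P. \<exists>j. set (take j ys) \<in> \<S>} \<noteq> {}"
  proof
    assume "{ys \<in> P. \<exists>j. set (take j ys) \<in> \<S>} = {}"
    then have "2 * fact (card C) \<le> r * card ({} :: 'a list set)" using hits unfolding P_def by argo
    then show False by simp
  qed
  then obtain S where "S \<in> \<S>" by blast
  then have m: "0 < m" using \<S>(2)[of S] by simp
  have "3 * m \<le> k" using mult_le_mono1[OF r(1), of m] r(2) unfolding k_def by linarith
  then have m2: "2 * m < k" using m by simp
  have single: "card {ys \<in> P. ev i ys} = card {ys \<in> P. \<exists>j. set (take j ys) \<in> \<S>}" for i
    unfolding ev_def P_def by (rule card_permutations_rotate)
  have pair: "(k - m) * card {ys \<in> P. ev i ys \<and> ev j ys} \<le> 2 * D * fact k" if ij: "(i, j) \<in> I" for i j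
  proof -
    define d where "d = j - i"
    have j: "j = i + d" "0 < d" "d + 1 \<le> r" using ij by (auto simp: d_def I_def)
    have dm: "(d + 1) * m \<le> card C" using mult_right_mono[OF j(3), of m] r(2) by simp
    let ?Q = "\<lambda>ys. (\<exists>j. set (take j ys) \<in> \<S>) \<and> (\<exists>j. set (take j (rotate (d * m) ys)) \<in> \<S>)"
    \<comment> \<open>Rotating by \<open>i * m\<close> moves block \<open>i\<close> to the front, so
      only the distance \<open>d\<close> of the two blocks matters.\<close>
    have "{ys \<in> P. ev i ys \<and> ev j ys} = {ys \<in> P. ?Q (rotate (i * m) ys)}"
      by (simp add: ev_def j(1) rotate_rotate algebra_simps)
    then have "card {ys \<in> P. ev i ys \<and> ev j ys} = card {ys \<in> P. ?Q ys}"
      unfolding P_def by (simp only: card_permutations_rotate[of C ?Q])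
    moreover have "(k - m) * card {ys \<in> P. ?Q ys} \<le> (card H + D) * fact k"
      unfolding k_def P_def H_def
      by (rule card_permutations_two_blocks_le[OF C \<S> j(2) dm m2[unfolded k_def] m])
    moreover have "\<dots> \<le> 2 * D * fact k" using HD by (intro mult_right_mono) auto
    ultimately show ?thesis by (metis le_trans)
  qed
  \<comment> \<open>Double counting of hit blocks over all permutations, followed by
    \<open>card_pairs_ge\<close> for each permutation.\<close>
  have "2 * fact k \<le> (\<Sum>i\<in>{..<r}. card {ys \<in> P. ev i ys})"
    using hits by (simp only: single) (simp add: P_def k_def)
  also have "\<dots> = (\<Sum>ys\<in>P. card {i \<in> {..<r}. ev i ys})"
    using finP by (intro sum_card_swap) auto
  also have "\<dots> \<le> (\<Sum>ys\<in>P. card {p \<in> I. ev (fst p) ys \<and> ev (snd p) ys} + 1)"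
  proof (intro sum_mono)
    fix ys
    have "{(i, j). i < j \<and> j < r \<and> ev i ys \<and> ev j ys} = {p \<in> I. ev (fst p) ys \<and> ev (snd p) ys}"
      by (auto simp: I_def)
    then show "card {i \<in> {..<r}. ev i ys} \<le> card {p \<in> I. ev (fst p) ys \<and> ev (snd p) ys} + 1"
      using card_pairs_ge[of r "\<lambda>i. ev i ys"] by simp
  qed
  also have "\<dots> = (\<Sum>ys\<in>P. card {p \<in> I. ev (fst p) ys \<and> ev (snd p) ys}) + fact k"
    by (simp only: sum.distrib) (simp add: cardP)
  also have "(\<Sum>ys\<in>P. card {p \<in> I. ev (fst p) ys \<and> ev (snd p) ys}) =
      (\<Sum>p\<in>I. card {ys \<in> P. ev (fst p) ys \<and> ev (snd p) ys})"
    using finP finI by (intro sum_card_swap) auto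
  finally have "fact k \<le> (\<Sum>p\<in>I. card {ys \<in> P. ev (fst p) ys \<and> ev (snd p) ys})" by simp
  then have "(k - m) * fact k \<le> (k - m) * (\<Sum>p\<in>I. card {ys \<in> P. ev (fst p) ys \<and> ev (snd p) ys})"
    by (rule mult_le_mono2)
  also have "\<dots> = (\<Sum>p\<in>I. (k - m) * card {ys \<in> P. ev (fst p) ys \<and> ev (snd p) ys})"
    by (rule sum_distrib_left)
  also have "\<dots> \<le> (\<Sum>p\<in>I. 2 * D * fact k)"
    using pair by (intro sum_mono) auto
  also have "\<dots> \<le> r\<^sup>2 * (2 * D * fact k)" using cardI by simp
  finally have "(k - m) * fact k \<le> (2 * r\<^sup>2 * D) * fact k" by (simp add: mult_ac)
  then show False using D by (simp add: k_def)
qed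

section \<open>Branching on union-free families\<close>

text \<open>A member \<open>B\<close> in the same union-free family as \<open>C\<close> rules out at
  least \<open>D\<close> sets \<open>A\<close>. The strict inclusions make the three sets distinct:
  \<open>A = B\<close> would give \<open>B = C\<close>.\<close>

definition dense_below :: "nat \<Rightarrow> 'a set set \<Rightarrow> 'a set \<Rightarrow> 'a set set" where
  "dense_below D G C = {B \<in> G. B \<subset> C \<and> D \<le> card {A \<in> G. A \<subset> C \<and> A \<union> B = C}}"

text \<open>Branch on whether \<open>C \<in> F\<close>. If so, either \<open>F\<close> misses \<open>D\<close> chosen sets \<open>B\<close>, or it contains
  one of them and then misses all \<open>A\<close> with \<open>A \<union> B = C\<close>. This gives the recursion
  \<open>a g \<le> a (g - 1) + (D + 1) * a (g - D)\<close>, which \<open>x ^ g\<close> majorizes.\<close>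
lemma card_union_free_between_le:
  fixes V :: "'a set set" and x :: real
  assumes V: "finite V" and x: "1 \<le> x" "x ^ (D - 1) + (D + 1) \<le> x ^ D" and D: "0 < D"
    and dense: "\<And>G. G \<subseteq> V \<Longrightarrow> M < card G \<Longrightarrow> \<exists>C\<in>G. D \<le> card (dense_below D G C)"
    and G: "G \<subseteq> V"
  shows "real (card {F. T \<subseteq> F \<and> F \<subseteq> T \<union> G \<and> union_free F}) \<le> 2 ^ M * x ^ card G"
  using G
proof (induction "card G" arbitrary: G T rule: less_induct)
  case less
  \<comment> \<open>\<open>T\<close> holds the sets already decided to lie in \<open>F\<close>, and
    \<open>G\<close> the sets still undecided.\<close>
  define N where "N T G = {F. T \<subseteq> F \<and> F \<subseteq> T \<union> G \<and> union_free F}" for T G :: "'a set set"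
  have finG: "finite G" using less.prems V by (rule finite_subset)
  have N: "finite (N T G')" "card (N T G') \<le> 2 ^ card G'" if "G' \<subseteq> G" for T G'
  proof -
    have f: "finite (Pow G')" using finG that by (simp add: finite_subset)
    have sub: "N T G' \<subseteq> (\<lambda>H. T \<union> H) ` Pow G'"
    proof
      fix F assume "F \<in> N T G'"
      then have "F = T \<union> (F \<inter> G')" by (auto simp: N_def)
      then show "F \<in> (\<lambda>H. T \<union> H) ` Pow G'" by blast
    qed
    show "finite (N T G')" using f sub by (meson finite_imageI finite_subset)
    show "card (N T G') \<le> 2 ^ card G'"
      using surj_card_le[OF f sub] f by (simp add: card_Pow)
  qed
  show ?case
  proof (cases "M < card G")
    case False
    have "real (card (N T G)) \<le> real (2 ^ card G)" by (intro of_nat_mono N(2)) simp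
    also have "\<dots> = 2 ^ card G" by simp
    also have "\<dots> \<le> 2 ^ M" using False by (intro power_increasing) auto
    also have "\<dots> \<le> 2 ^ M * x ^ card G" using x(1) by simp
    finally show ?thesis by (simp add: N_def)
  next
    case True
    obtain C where C: "C \<in> G" "D \<le> card (dense_below D G C)" using dense[OF less.prems True] by blast
    obtain H where H: "H \<subseteq> dense_below D G C" "card H = D" "finite H"
      using obtain_subset_with_card_n[OF C(2)] by metis
    define nb where "nb B = {A \<in> G. A \<subset> C \<and> A \<union> B = C}" for B
    have Hsub: "H \<subseteq> G" using H by (auto simp: dense_below_def)
    have g: "D \<le> card G" using Hsub H finG card_mono by metis
    \<comment> \<open>Bounds every branch that removes at least \<open>j\<close> sets from
      \<open>G\<close>. The recorded sets \<open>T'\<close> do not affect the bound, and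
      \<open>1 \<le> x\<close> absorbs additional removals.\<close>
    have IH: "card (N T' G') \<le> 2 ^ M * x ^ (card G - j)"
      if "G' \<subseteq> G - R" "R \<subseteq> G" "j \<le> card R" "0 < j" for T' G' R j
    proof -
      have fR: "finite R" using that finG by (simp add: finite_subset)
      have "card G' \<le> card (G - R)" using that finG by (intro card_mono) auto
      also have "\<dots> = card G - card R" using that fR by (simp add: card_Diff_subset)
      finally have le: "card G' \<le> card G - j" using that by simp
      have "0 < card G" using C finG by (auto simp: card_gt_0_iff)
      then have "card G' < card G" using le that by linarith
      then have "card (N T' G') \<le> 2 ^ M * x ^ card G'"
        unfolding N_def using that less.prems by (intro less.hyps) auto
      also have "\<dots> \<le> 2 ^ M * x ^ (card G - j)"
        using le x(1) by (intro mult_left_mono power_increasing) auto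
      finally show ?thesis .
    qed
    \<comment> \<open>The branches: \<open>C\<close> is absent; \<open>C\<close> is present and
      \<open>H\<close> is missed; \<open>C\<close> and some \<open>B\<close> in \<open>H\<close> are
      both present. The last two kinds number \<open>D + 1\<close> and each removes at least
      \<open>D\<close> sets.\<close>
    define N0 where "N0 = N T (G - {C})"
    define N1 where "N1 = N (insert C T) (G - H)"
    define N2 where "N2 B = N (insert C (insert B T)) (G - nb B)" for B
    have N0: "card N0 \<le> 2 ^ M * x ^ (card G - 1)"
      unfolding N0_def using C by (intro IH[where R = "{C}"]) auto
    have N1: "card N1 \<le> 2 ^ M * x ^ (card G - D)"
      unfolding N1_def using H Hsub D by (intro IH[where R = H]) auto
    have N2: "card (N2 B) \<le> 2 ^ M * x ^ (card G - D)" if "B \<in> H" for B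
    proof -
      have "D \<le> card (nb B)" using H(1) that by (auto simp: nb_def dense_below_def)
      moreover have "nb B \<subseteq> G" by (auto simp: nb_def)
      ultimately show ?thesis unfolding N2_def using D by (intro IH[OF order_refl])
    qed
    have "N T G \<subseteq> N0 \<union> N1 \<union> (\<Union>B\<in>H. N2 B)"
    proof
      fix F assume "F \<in> N T G"
      then have F: "T \<subseteq> F" "F \<subseteq> T \<union> G" "union_free F" by (auto simp: N_def)
      consider "C \<notin> F" | "C \<in> F" "F \<inter> H = {}" | B where "C \<in> F" "B \<in> F" "B \<in> H" by blast
      then show "F \<in> N0 \<union> N1 \<union> (\<Union>B\<in>H. N2 B)"
      proof cases
        case 1
        then show ?thesis using F by (auto simp: N0_def N_def)
      next
        case 2
        then show ?thesis using F by (auto simp: N1_def N_def)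
      next
        case 3
        have BC: "B \<subset> C" using 3 H by (auto simp: dense_below_def)
        have "A \<notin> F" if "A \<in> nb B" for A
        proof
          assume "A \<in> F"
          moreover have "A \<noteq> B" "A \<noteq> C" "A \<union> B = C" using that BC by (auto simp: nb_def)
          ultimately show False using F(3) 3 BC unfolding union_free_def by blast
        qed
        then have "F \<in> N2 B" using F 3 by (auto simp: N2_def N_def)
        then show ?thesis using 3 by blast
      qed
    qed
    moreover have "finite N0" "finite N1" "finite (N2 B)" for B
      unfolding N0_def N1_def N2_def by (intro N(1) Diff_subset)+
    then have "finite (N0 \<union> N1 \<union> (\<Union>B\<in>H. N2 B))" using H(3) by simp
    ultimately have "card (N T G) \<le> card (N0 \<union> N1 \<union> (\<Union>B\<in>H. N2 B))" by (rule card_mono[rotated])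
    also have "\<dots> \<le> card N0 + card N1 + card (\<Union>B\<in>H. N2 B)"
      using card_Un_le[of N0 N1] card_Un_le[of "N0 \<union> N1" "\<Union>B\<in>H. N2 B"] by linarith
    also have "card (\<Union>B\<in>H. N2 B) \<le> (\<Sum>B\<in>H. card (N2 B))" by (rule card_UN_le[OF H(3)])
    finally have "card (N T G) \<le> card N0 + card N1 + (\<Sum>B\<in>H. card (N2 B))" by simp
    then have "real (card (N T G)) \<le> real (card N0 + card N1 + (\<Sum>B\<in>H. card (N2 B)))"
      by (rule of_nat_mono)
    also have "\<dots> = card N0 + card N1 + (\<Sum>B\<in>H. real (card (N2 B)))" by simp
    also have "\<dots> \<le> 2 ^ M * x ^ (card G - 1) + 2 ^ M * x ^ (card G - D) + (\<Sum>B\<in>H. 2 ^ M * x ^ (card G - D))"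
      using N0 N1 N2 by (intro add_mono sum_mono) auto
    also have "\<dots> = 2 ^ M * (x ^ (card G - 1) + (D + 1) * x ^ (card G - D))"
      using H by (simp add: algebra_simps)
    \<comment> \<open>Factoring out \<open>x ^ (card G - D)\<close> leaves exactly the left side of
      the hypothesis on \<open>x\<close>.\<close>
    also have "card G - 1 = (card G - D) + (D - 1)" using g D by simp
    also have "x ^ ((card G - D) + (D - 1)) + (D + 1) * x ^ (card G - D) = x ^ (card G - D) * (x ^ (D - 1) + (D + 1))"
      by (simp add: power_add algebra_simps)
    also have "\<dots> \<le> x ^ (card G - D) * x ^ D" using x by (intro mult_left_mono) auto
    also have "\<dots> = x ^ card G" using g by (simp flip: power_add)
    finally show ?thesis by (simp add: N_def)
  qed
qed

text \<open>Take complements inside \<open>C\<close>: for subsets \<open>S\<close> and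
  \<open>S'\<close> of \<open>C\<close>, the union of \<open>C - S\<close> and \<open>C - S'\<close>
  is \<open>C\<close> exactly when \<open>S\<close> and \<open>S'\<close> are disjoint. Removing a
  prefix \<open>S\<close> from an ordering of \<open>C\<close> lands in \<open>G\<close> exactly
  when \<open>C - S\<close> does, so chain hits become prefix hits.\<close>

lemma dense_below_of_many_hits:
  fixes G :: "'a set set"
  assumes C: "C \<in> G" "finite C" and m: "\<And>A. A \<in> G \<Longrightarrow> A \<subset> C \<Longrightarrow> card C \<le> card A + m"
    and r: "3 \<le> r" "r * m \<le> card C" and D: "2 * r\<^sup>2 * D < card C - m"
    and hits: "2 * fact (card C) \<le> r * card {ys \<in> permutations_of_set C. \<exists>j\<in>{1..card C}. set (drop j ys) \<in> G}"
  shows "D \<le> card (dense_below D G C)"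
proof -
  define \<S> where "\<S> = {S. S \<subseteq> C \<and> S \<noteq> {} \<and> C - S \<in> G}"
  have S: "\<S> \<subseteq> Pow C" by (auto simp: \<S>_def)
  have Sm: "0 < card S \<and> card S \<le> m" if "S \<in> \<S>" for S
  proof -
    have *: "S \<subseteq> C" "S \<noteq> {}" "finite S" using that C finite_subset by (auto simp: \<S>_def)
    have "card C \<le> card (C - S) + m" using that by (intro m) (auto simp: \<S>_def)
    moreover have "card (C - S) = card C - card S" using * by (simp add: card_Diff_subset)
    moreover have "card S \<le> card C" using * C by (simp add: card_mono)
    ultimately show ?thesis using * by (auto simp: card_gt_0_iff)
  qed
  have "card {ys \<in> permutations_of_set C. \<exists>j\<in>{1..card C}. set (drop j ys) \<in> G}
      \<le> card {ys \<in> permutations_of_set C. \<exists>j. set (take j ys) \<in> \<S>}"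
  proof (intro card_mono subsetI)
    fix ys assume "ys \<in> {ys \<in> permutations_of_set C. \<exists>j\<in>{1..card C}. set (drop j ys) \<in> G}"
    then obtain j where ys: "ys \<in> permutations_of_set C" and j: "j \<in> {1..card C}" "set (drop j ys) \<in> G"
      by blast
    have "set (drop j ys) = C - set (take j ys)" using permutations_of_set_split(3)[OF ys] .
    moreover have "set (take j ys) \<subseteq> C" using ys by (auto simp: permutations_of_set_def dest: in_set_takeD)
    moreover have "set (take j ys) \<noteq> {}" using card_take_permutation[OF ys, of j] j by auto
    ultimately show "ys \<in> {ys \<in> permutations_of_set C. \<exists>j. set (take j ys) \<in> \<S>}"
      using j ys by (auto simp: \<S>_def)
  qed simp
  then have "2 * fact (card C) \<le> r * card {ys \<in> permutations_of_set C. \<exists>j. set (take j ys) \<in> \<S>}"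
    using hits by (meson le_trans mult_le_mono2)
  then have 1: "D \<le> card {S \<in> \<S>. D \<le> card {S' \<in> \<S>. S \<inter> S' = {}}}"
    by (intro many_disjoint_pairs[OF C(2) S _ r D] Sm)
  have inj: "inj_on (\<lambda>S. C - S) \<S>" by (auto simp: inj_on_def \<S>_def)
  have below: "finite {A. A \<subset> C \<and> Q A}" for Q
    by (rule finite_subset[of _ "Pow C"]) (use C in auto)
  have "(\<lambda>S. C - S) ` {S \<in> \<S>. D \<le> card {S' \<in> \<S>. S \<inter> S' = {}}} \<subseteq> dense_below D G C"
  proof (intro image_subsetI)
    fix S assume "S \<in> {S \<in> \<S>. D \<le> card {S' \<in> \<S>. S \<inter> S' = {}}}"
    then have S: "S \<in> \<S>" "D \<le> card {S' \<in> \<S>. S \<inter> S' = {}}" by auto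
    have fin: "finite {A \<in> G. A \<subset> C \<and> A \<union> (C - S) = C}"
      by (rule finite_subset[OF _ below[of "\<lambda>_. True"]]) auto
    have "card {S' \<in> \<S>. S \<inter> S' = {}} \<le> card {A \<in> G. A \<subset> C \<and> A \<union> (C - S) = C}"
      using S(1) by (intro card_inj_on_le[OF inj_on_subset[OF inj] _ fin]) (auto simp: \<S>_def)
    then show "C - S \<in> dense_below D G C" using S by (auto simp: dense_below_def \<S>_def)
  qed
  moreover have "finite (dense_below D G C)"
    by (rule finite_subset[OF _ below[of "\<lambda>_. True"]]) (auto simp: dense_below_def)
  ultimately have "card {S \<in> \<S>. D \<le> card {S' \<in> \<S>. S \<inter> S' = {}}} \<le> card (dense_below D G C)"
    by (intro card_inj_on_le[OF inj_on_subset[OF inj]]) auto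
  with 1 show ?thesis by (rule le_trans)
qed

section \<open>Binomial estimates\<close>

text \<open>The deviation is a sum of \<open>card X\<close> independent random signs, so its
  variance is \<open>card X\<close>. In the induction a new element shifts it by plus or minus 1 and
  the cross terms cancel.\<close>

lemma sum_Pow_deviation_square:
  assumes "finite X"
  shows "(\<Sum>A\<in>Pow X. (real (card X) - 2 * real (card A))\<^sup>2) = card X * 2 ^ card X"
  using assms
proof (induction X)
  case (insert x X)
  let ?y = "\<lambda>A. real (card X) - 2 * real (card A)"
  have fin: "finite A" if "A \<in> Pow X" for A using that insert by (auto intro: finite_subset)
  have inj: "inj_on (Set.insert x) (Pow X)" using insert by (auto simp: inj_on_def)
  have "(\<Sum>A\<in>Pow (Set.insert x X). (real (card (Set.insert x X)) - 2 * real (card A))\<^sup>2)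
      = (\<Sum>A\<in>Pow X. (?y A + 1)\<^sup>2) + (\<Sum>A\<in>Set.insert x ` Pow X. (real (card X) + 1 - 2 * real (card A))\<^sup>2)"
    using insert unfolding Pow_insert by (subst sum.union_disjoint) (auto simp: algebra_simps)
  also have "(\<Sum>A\<in>Set.insert x ` Pow X. (real (card X) + 1 - 2 * real (card A))\<^sup>2)
      = (\<Sum>A\<in>Pow X. (?y A - 1)\<^sup>2)"
    unfolding sum.reindex[OF inj] using insert fin by (intro sum.cong) (auto simp: card_insert_if algebra_simps)
  also have "(\<Sum>A\<in>Pow X. (?y A + 1)\<^sup>2) + (\<Sum>A\<in>Pow X. (?y A - 1)\<^sup>2) = (\<Sum>A\<in>Pow X. 2 * (?y A)\<^sup>2 + 2)"
    unfolding sum.distrib[symmetric] by (intro sum.cong) (auto simp: power2_eq_square algebra_simps)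
  also have "\<dots> = 2 * (card X * 2 ^ card X) + 2 * 2 ^ card X"
    using insert by (simp add: sum.distrib card_Pow flip: sum_distrib_left)
  finally show ?case using insert by (simp add: algebra_simps)
qed simp

text \<open>Chebyshev's inequality: each set counted contributes at least
  \<open>(real m)\<^sup>2\<close> to the second moment.\<close>

lemma card_far_from_middle_le:
  assumes "finite X" "0 < m"
  shows "real (card {A \<in> Pow X. real m < \<bar>real (card X) - 2 * real (card A)\<bar>}) \<le> card X * 2 ^ card X / (real m)\<^sup>2"
proof -
  let ?B = "{A \<in> Pow X. real m < \<bar>real (card X) - 2 * real (card A)\<bar>}"
  have "real (card ?B) * (real m)\<^sup>2 \<le> (\<Sum>A\<in>?B. (real (card X) - 2 * real (card A))\<^sup>2)"
    using sum_bounded_below[of ?B "(real m)\<^sup>2" "\<lambda>A. (real (card X) - 2 * real (card A))\<^sup>2"]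
    by (force simp: abs_le_square_iff[symmetric])
  also have "\<dots> \<le> (\<Sum>A\<in>Pow X. (real (card X) - 2 * real (card A))\<^sup>2)"
    using assms by (intro sum_mono2) auto
  also have "\<dots> = card X * 2 ^ card X" by (rule sum_Pow_deviation_square[OF assms(1)])
  finally show ?thesis using assms by (simp add: pos_le_divide_eq)
qed

text \<open>Consecutive central coefficients have ratio \<open>2 * (2 * p + 1) / (p + 1)\<close>,
  and \<open>4 * p * (p + 1) \<le> (2 * p + 1)\<^sup>2\<close> carries the induction. Equality holds
  at \<open>p = 1\<close>.\<close>

lemma central_binomial_even_ge:
  assumes "0 < p"
  shows "16 ^ p \<le> 4 * p * (2 * p choose p)\<^sup>2"
  using assms
proof (induction p rule: nat_induct_non_zero)
  case (Suc p)
  have rec: "Suc p * (2 * Suc p choose Suc p) = 2 * (2 * p + 1) * (2 * p choose p)"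
  proof -
    have "Suc p * (2 * Suc p choose Suc p) = (2 * Suc p) * (2 * p + 1 choose p)"
      using Suc_times_binomial_eq[of "2 * p + 1" p] by (simp add: mult.commute)
    also have "2 * p + 1 choose p = (2 * p + 1 choose Suc p)"
      using binomial_symmetric[of p "2 * p + 1"] by simp
    also have "(2 * Suc p) * (2 * p + 1 choose Suc p) = 2 * ((2 * p + 1) * (2 * p choose p))"
      using Suc_times_binomial_eq[of "2 * p" p] by (simp add: mult_ac)
    finally show ?thesis by simp
  qed
  have "Suc p * 16 ^ Suc p \<le> 16 * Suc p * (4 * p * (2 * p choose p)\<^sup>2)"
    using mult_le_mono2[OF Suc.IH, of "16 * Suc p"] by (simp only: power_Suc mult_ac)
  also have "\<dots> = 16 * (4 * p * (p + 1)) * (2 * p choose p)\<^sup>2" by (simp add: algebra_simps)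
  also have "\<dots> \<le> 16 * (2 * p + 1)\<^sup>2 * (2 * p choose p)\<^sup>2"
    by (intro mult_mono) (auto simp: power2_eq_square algebra_simps)
  also have "\<dots> = 4 * (2 * (2 * p + 1) * (2 * p choose p))\<^sup>2" by (simp only: power_mult_distrib) simp
  also have "\<dots> = 4 * (Suc p * (2 * Suc p choose Suc p))\<^sup>2" by (simp only: rec)
  also have "\<dots> = Suc p * (4 * Suc p * (2 * Suc p choose Suc p)\<^sup>2)"
    by (simp only: power2_eq_square mult_ac)
  finally show ?case by (simp only: mult_le_cancel1)
qed simp

lemma central_binomial_ge:
  assumes "1 \<le> n"
  shows "2 ^ n \<le> 2 * sqrt n * (n choose (n div 2))"
proof -
  have *: "4 ^ n \<le> 4 * n * (n choose (n div 2))\<^sup>2"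
  proof (cases "even n")
    case True
    then obtain p where p: "n = 2 * p" by blast
    then show ?thesis using central_binomial_even_ge[of p] assms by (simp add: power_mult) 
  next
    case False
    then obtain p where p: "n = 2 * p + 1" by (metis oddE)
    have "2 * p + 1 choose p = (2 * p + 1 choose Suc p)"
      using binomial_symmetric[of p "2 * p + 1"] by simp
    \<comment> \<open>For odd \<open>n\<close> the two equal middle entries of row \<open>n\<close>
      add up to the central entry of row \<open>n + 1\<close>, which reduces to the even
      case.\<close>
    then have "2 * Suc p choose Suc p = 2 * (n choose (n div 2))" by (simp add: p)
    have "16 ^ Suc p \<le> 4 * Suc p * (2 * (n choose (n div 2)))\<^sup>2"
      using central_binomial_even_ge[of "Suc p"] \<open>2 * Suc p choose Suc p = _\<close> by (simp only: zero_less_Suc)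
    also have "\<dots> = 16 * Suc p * (n choose (n div 2))\<^sup>2"
      by (simp add: power2_eq_square algebra_simps)
    finally have "16 ^ Suc p \<le> 16 * Suc p * (n choose (n div 2))\<^sup>2" .
    moreover have "(16 :: nat) ^ Suc p = 4 * 4 ^ n" by (simp add: p power_mult)
    moreover have "16 * Suc p * (n choose (n div 2))\<^sup>2 \<le> 4 * (4 * n * (n choose (n div 2))\<^sup>2)"
      using p by (simp add: mult_right_mono)
    ultimately show ?thesis by linarith
  qed
  have "(2 ^ n)\<^sup>2 = (4 :: real) ^ n" by (simp add: power2_eq_square flip: power_mult_distrib)
  also have "\<dots> \<le> 4 * real n * (real (n choose (n div 2)))\<^sup>2"
    using of_nat_mono[OF *, where ?'a = real] by simp
  also have "\<dots> = (2 * sqrt n * (n choose (n div 2)))\<^sup>2" by (simp add: power_mult_distrib)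
  finally have "(2 ^ n)\<^sup>2 \<le> (2 * sqrt n * (n choose (n div 2)))\<^sup>2" .
  then show ?thesis by (rule power2_le_imp_le) simp
qed

section \<open>Counting union-free families\<close>

lemma union_free_subset: "union_free F \<Longrightarrow> E \<subseteq> F \<Longrightarrow> union_free E"
  unfolding union_free_def by (meson subset_eq)

lemma num_union_free_ge: "2 ^ (n choose (n div 2)) \<le> num_union_free n"
proof -
  define L where "L = {A. A \<subseteq> {1..n} \<and> card A = n div 2}"
  have "finite L" by (rule finite_subset[of _ "Pow {1..n}"]) (auto simp: L_def)
  have "union_free F" if F: "F \<subseteq> L" for F
    unfolding union_free_def
  proof clarify
    fix A B assume AB: "A \<in> F" "A \<union> B \<in> F" "A \<noteq> A \<union> B"
    then have "A \<union> B \<in> L" "A \<in> L" using F by blast+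
    then have "A \<subset> A \<union> B" "finite (A \<union> B)" "card A = card (A \<union> B)"
      using AB(3) finite_subset[OF _ finite_atLeastAtMost[of 1 n]] by (simp_all add: L_def psubset_eq)
    then show False using psubset_card_mono by (metis less_irrefl)
  qed
  then have "Pow L \<subseteq> {F. F \<subseteq> Pow {1..n} \<and> union_free F}" by (auto simp: L_def)
  moreover have "card (Pow L) = 2 ^ (n choose (n div 2))"
    using n_subsets[of "{1..n}" "n div 2"] \<open>finite L\<close> by (simp add: card_Pow L_def)
  moreover have "finite {F. F \<subseteq> Pow {1..n} \<and> union_free F}"
    by (rule finite_subset[of _ "Pow (Pow {1..n})"]) auto
  ultimately show ?thesis unfolding num_union_free_def by (metis card_mono)
qed

text \<open>The three summands are the sets left when branching stops, the sets far from the middle,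
  and the cost of branching. The divisors in \<open>m\<close> and \<open>D\<close> ensure that every
  \<open>C\<close> near the middle satisfies \<open>r * m \<le> card C\<close> and
  \<open>2 * r\<^sup>2 * D < card C - m\<close>.\<close>

lemma num_union_free_le:
  fixes n r :: nat
  defines "m \<equiv> n div (4 * r)" and "D \<equiv> n div (16 * r\<^sup>2)"
  assumes r: "3 \<le> r" and pos: "0 < m" "0 < D"
    and x: "1 \<le> x" "x ^ (D - 1) + (D + 1) \<le> x ^ D"
  shows "log 2 (num_union_free n) \<le>
    (n choose (n div 2)) * (r / (r - 2)) + n * 2 ^ n / (real m)\<^sup>2 + 2 ^ n * log 2 x"
proof -
  define X where "X = {1..n}"
  have X: "finite X" "card X = n" by (auto simp: X_def)
  define N where "N = n choose (n div 2)"
  define M where "M = nat \<lfloor>N * (r / (r - 2))\<rfloor>"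
  define V where "V = {A \<in> Pow X. \<not> real m < \<bar>real (card X) - 2 * real (card A)\<bar>}"
  define W where "W = {A \<in> Pow X. real m < \<bar>real (card X) - 2 * real (card A)\<bar>}"
  have fin: "finite V" "finite W" using X by (auto simp: V_def W_def)
  have VW: "V \<union> W = Pow X" by (auto simp: V_def W_def)
  have n: "0 < n" using pos by (auto simp: m_def intro: Nat.gr0I)
  have rm: "4 * (r * m) \<le> n"
    using div_times_less_eq_dividend[of n "4 * r"] by (simp add: m_def mult_ac)
  have m12: "12 * m \<le> n"
    using rm mult_le_mono1[OF r, of m] by linarith
  have D: "16 * (r\<^sup>2 * D) \<le> n"
    using div_times_less_eq_dividend[of n "16 * r\<^sup>2"] by (simp add: D_def mult_ac)
  have dense: "\<exists>C\<in>G. D \<le> card (dense_below D G C)" if G: "G \<subseteq> V" "M < card G" for G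
  proof -
    let ?hits = "\<lambda>C. card {ys \<in> permutations_of_set C. \<exists>j\<in>{1..card C}. set (drop j ys) \<in> G}"
    \<comment> \<open>Contrapositive of the LYM bound with \<open>\<eta> = 2 / r\<close>; the factor
      \<open>r / (r - 2)\<close> in \<open>M\<close> is \<open>1 / (1 - \<eta>)\<close>.\<close>
    have "\<exists>C\<in>G. 2 / real r * fact (card C) < ?hits C"
    proof (rule ccontr)
      assume "\<not> ?thesis"
      then have "(1 - 2 / real r) * card G \<le> (card X choose (card X div 2))"
        using G X by (intro card_le_central_binomial_of_few_hits) (auto simp: V_def not_less)
      then have "(1 - 2 / real r) * card G \<le> N" by (simp add: X N_def)
      then have "card G \<le> N * (r / (r - 2))" using r by (simp add: field_simps of_nat_diff)
      then have "card G \<le> M" by (simp add: M_def le_nat_floor)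
      then show False using G by simp
    qed
    then obtain C where C: "C \<in> G" "2 / real r * fact (card C) < ?hits C" by blast
    then have "2 * fact (card C) < real r * ?hits C" using r by (simp add: field_simps)
    then have "real (2 * fact (card C)) \<le> real (r * ?hits C)" by simp
    then have hits: "2 * fact (card C) \<le> r * ?hits C" by (simp only: of_nat_le_iff)
    \<comment> \<open>Since the deviation is measured on \<open>2 * card A\<close>, any two sizes in
      \<open>V\<close> differ by at most \<open>m\<close>, which is the block length.\<close>
    have mid: "2 * card A \<le> n + m" "n \<le> 2 * card A + m" if "A \<in> G" for A
      using that G X by (auto simp: V_def abs_le_iff not_less)
    have finC: "finite C" using C G X by (auto simp: V_def intro: finite_subset)
    have "card C \<le> card A + m" if "A \<in> G" for A using mid[OF that] mid[OF C(1)] by linarith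
    moreover have "r * m \<le> card C" using mid[OF C(1)] rm m12 by linarith
    moreover have "2 * r\<^sup>2 * D < card C - m" using mid[OF C(1)] D m12 n by simp
    ultimately have "D \<le> card (dense_below D G C)"
      by (intro dense_below_of_many_hits[OF C(1) finC _ r _ _ hits])
    then show ?thesis using C by blast
  qed
  let ?U = "{F. F \<subseteq> V \<and> union_free F}"
  have U: "real (card ?U) \<le> 2 ^ M * x ^ card V"
    using card_union_free_between_le[OF fin(1) x pos(2) dense order_refl, where T = "{}"] by simp
  have cardV: "card V \<le> 2 ^ n"
    using card_mono[of "Pow X" V] X VW by (auto simp: card_Pow)
  have cardW: "card W \<le> n * 2 ^ n / (real m)\<^sup>2"
    using card_far_from_middle_le[OF X(1) pos(1)] by (simp add: W_def X)
  \<comment> \<open>A family splits into its part in \<open>W\<close>, bounded trivially, and its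
    part in \<open>V\<close>, which is still union-free.\<close>
  have "num_union_free n \<le> card (Pow W \<times> ?U)"
    unfolding num_union_free_def
  proof (rule card_inj_on_le[where f = "\<lambda>F. (F \<inter> W, F \<inter> V)"])
    show "inj_on (\<lambda>F. (F \<inter> W, F \<inter> V)) {F. F \<subseteq> Pow {1..n} \<and> union_free F}"
    proof (rule inj_onI)
      fix F F' assume "F \<in> {F. F \<subseteq> Pow {1..n} \<and> union_free F}" "F' \<in> {F. F \<subseteq> Pow {1..n} \<and> union_free F}"
        and eq: "(F \<inter> W, F \<inter> V) = (F' \<inter> W, F' \<inter> V)"
      then have "F = F \<inter> (V \<union> W)" "F' = F' \<inter> (V \<union> W)" by (auto simp only: VW X_def)
      then show "F = F'" using eq by blast
    qed
    show "(\<lambda>F. (F \<inter> W, F \<inter> V)) ` {F. F \<subseteq> Pow {1..n} \<and> union_free F} \<subseteq> Pow W \<times> ?U"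
      by (auto intro: union_free_subset)
    show "finite (Pow W \<times> ?U)" using fin by simp
  qed
  also have "\<dots> = 2 ^ card W * card ?U" using fin by (simp add: card_cartesian_product card_Pow)
  finally have "real (num_union_free n) \<le> real (2 ^ card W * card ?U)" by (rule of_nat_mono)
  also have "\<dots> \<le> 2 ^ card W * (2 ^ M * x ^ card V)" using U by simp
  also have "\<dots> \<le> 2 ^ card W * (2 ^ M * x ^ 2 ^ n)"
    using cardV x by (intro mult_left_mono power_increasing) auto
  finally have le: "real (num_union_free n) \<le> 2 ^ card W * (2 ^ M * x ^ 2 ^ n)" .
  have "0 < num_union_free n" using num_union_free_ge[of n] by (rule less_le_trans[rotated]) simp
  then have "log 2 (num_union_free n) \<le> log 2 (2 ^ card W * (2 ^ M * x ^ 2 ^ n))"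
    using le by (intro log_mono) auto
  also have "\<dots> = card W + (M + 2 ^ n * log 2 x)"
    using x by (simp add: log_mult log_nat_power)
  also have "M \<le> N * (r / (r - 2))" unfolding M_def using r by (simp add: of_nat_diff)
  finally show ?thesis using cardW by (simp add: N_def)
qed

section \<open>Choice of the branching base and passage to the limit\<close>

lemma branching_base_eventually:
  "\<forall>\<^sub>F D::nat in sequentially. 0 < D \<and>
     (1 + real D powr (-3/4)) ^ (D - 1) + (D + 1) \<le> (1 + real D powr (-3/4)) ^ D"
proof -
  \<comment> \<open>With \<open>y = D powr (-3/4)\<close> the power of \<open>1 + y\<close> grows
    roughly like \<open>exp (D powr (1/4))\<close> and beats every polynomial. The exponent lies
    strictly between 1/2 and 1: \<open>D * y\<close> must outgrow \<open>ln D\<close>, while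
    \<open>sqrt n * y\<close> must tend to 0 for \<open>D\<close> linear in
    \<open>n\<close>.\<close>
  have "\<forall>\<^sub>F D::nat in sequentially. real D + 1 \<le> real D powr (-3/4) * (1 + real D powr (-3/4)) powr (real D - 1)"
    by real_asymp
  moreover have "\<forall>\<^sub>F D::nat in sequentially. 0 < D" by real_asymp
  ultimately show ?thesis
  proof eventually_elim
    case (elim D)
    define y where "y = real D powr (-3/4)"
    have y: "0 < 1 + y" by (simp add: y_def add_pos_nonneg)
    have "real D - 1 = real (D - 1)" using elim(2) by simp
    then have "(1 + y) powr (real D - 1) = (1 + y) ^ (D - 1)"
      using y by (simp only: powr_realpow)
    then have "real D + 1 \<le> y * (1 + y) ^ (D - 1)" using elim(1) by (simp only: y_def)
    moreover have "(1 + y) ^ D = (1 + y) ^ (D - 1) + y * (1 + y) ^ (D - 1)"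
      using elim(2) by (cases D) (simp_all add: algebra_simps)
    ultimately show ?case using elim(2) unfolding y_def[symmetric] by linarith
  qed
qed

lemma real_of_nat_div_ge: "real n / real c - 1 \<le> real (n div c)"
  using floor_correct[of "real n / real c"] by (simp add: floor_divide_of_nat_eq)

text \<open>Divides the previous bound by the central binomial coefficient, using
  \<open>2 ^ n \<le> 2 * sqrt n * (n choose (n div 2))\<close>, and replaces the integer quotients
  by real expressions in \<open>n\<close>.\<close>

lemma log_num_union_free_eventually_le:
  fixes r :: nat
  assumes r: "3 \<le> r"
  shows "\<forall>\<^sub>F n in sequentially. log 2 (num_union_free n) / (n choose (n div 2)) \<le> r / (r - 2) +
    2 * sqrt n * (n / (n / (4 * r) - 1)\<^sup>2 + 2 * (n / (16 * r\<^sup>2) - 1) powr (-3/4))"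
proof -
  have lim: "filterlim (\<lambda>n. n div (16 * r\<^sup>2)) sequentially sequentially"
    using r by (intro filterlim_at_top_div_const_nat) auto
  \<comment> \<open>Makes both \<open>n / (4 * r) - 1\<close> and
    \<open>n / (16 * r\<^sup>2) - 1\<close> positive, as the monotonicity steps require.\<close>
  have "\<forall>\<^sub>F n in sequentially. 32 * r\<^sup>2 \<le> n" by (rule eventually_ge_at_top)
  with eventually_compose_filterlim[OF branching_base_eventually lim] show ?thesis
  proof eventually_elim
    case (elim n)
    define m where "m = n div (4 * r)"
    define D where "D = n div (16 * r\<^sup>2)"
    define N where "N = n choose (n div 2)"
    have "0 < N" by (simp add: N_def)
    define y where "y = real D powr (-3/4)"
    have "0 < r\<^sup>2" using r by simp
    have "4 * r \<le> 16 * r\<^sup>2" using r by (simp add: power2_eq_square)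
    then have "4 * r \<le> n" using elim(2) by linarith
    then have m: "0 < m" using r by (simp add: m_def div_greater_zero_iff)
    have n: "1 \<le> n" using \<open>4 * r \<le> n\<close> r by simp
    have "real n / (4 * r) - 1 \<le> m"
      using real_of_nat_div_ge[of n "4 * r"] by (simp add: m_def)
    moreover have "real n / (16 * r\<^sup>2) - 1 \<le> D"
      using real_of_nat_div_ge[of n "16 * r\<^sup>2"] by (simp add: D_def)
    moreover have "0 < real n / (16 * r\<^sup>2) - 1"
    proof -
      have "16 * r\<^sup>2 < n" using elim(2) \<open>0 < r\<^sup>2\<close> by linarith
      then have "real (16 * r\<^sup>2) < real n" by (simp only: of_nat_less_iff)
      then show ?thesis using r by (simp add: less_divide_eq)
    qed
    moreover have "0 < real n / (4 * r) - 1"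
    proof -
      have "4 * r < n" using \<open>4 * r \<le> 16 * r\<^sup>2\<close> elim(2) \<open>0 < r\<^sup>2\<close> by linarith
      then have "real (4 * r) < real n" by (simp only: of_nat_less_iff)
      then show ?thesis using r by (simp add: less_divide_eq)
    qed
    ultimately have le: "real n / (4 * r) - 1 \<le> m" "real n / (16 * r\<^sup>2) - 1 \<le> D"
      and pos: "0 < real n / (16 * r\<^sup>2) - 1" "0 < real n / (4 * r) - 1" by blast+
    have y: "y \<le> (real n / (16 * r\<^sup>2) - 1) powr (-3/4)"
      unfolding y_def using le(2) pos(1) by (intro powr_mono2') auto
    have "0 < (real n / (4 * r) - 1)\<^sup>2" "(real n / (4 * r) - 1)\<^sup>2 \<le> (real m)\<^sup>2"
      using le(1) pos(2) by (simp only: zero_less_power, intro power_mono) auto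
    then have msq: "real n / (real m)\<^sup>2 \<le> n / (real n / (4 * r) - 1)\<^sup>2"
      using m by (intro divide_left_mono mult_pos_pos) auto
    have "1 \<le> 1 + y" by (simp add: y_def)
    then have "log 2 (num_union_free n) \<le> N * (r / (r - 2)) + real (n * 2 ^ n) / (real m)\<^sup>2 + 2 ^ n * log 2 (1 + y)"
      using num_union_free_le[OF r m[unfolded m_def] conjunct1[OF elim(1)]] conjunct2[OF elim(1)]
      by (simp only: N_def m_def y_def D_def)
    also have "\<dots> = N * (r / (r - 2)) + 2 ^ n * (n / (real m)\<^sup>2 + log 2 (1 + y))"
      by (simp add: algebra_simps)
    also have "\<dots> \<le> N * (r / (r - 2)) + (2 * sqrt n * N) * (n / (real n / (4 * r) - 1)\<^sup>2 + 2 * (real n / (16 * r\<^sup>2) - 1) powr (-3/4))"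
    proof (intro add_left_mono mult_mono add_mono msq)
      show "2 ^ n \<le> 2 * sqrt n * N" unfolding N_def by (rule central_binomial_ge[OF n])
      have "0 \<le> y" by (simp add: y_def)
      \<comment> \<open>From \<open>ln (1 / 2) \<le> - 1 / 2\<close>; it gives the factor 2 in
        \<open>log 2 (1 + y) \<le> 2 * y\<close>.\<close>
      have "1 / 2 \<le> ln (2 :: real)" using ln_le_minus_one[of "1 / 2"] by (simp add: ln_div)
      have "log 2 (1 + y) \<le> y / ln 2"
        unfolding log_def using ln_add_one_self_le_self[OF \<open>0 \<le> y\<close>] by (simp add: divide_right_mono)
      also have "\<dots> \<le> y / (1 / 2)"
        using \<open>1 / 2 \<le> ln 2\<close> \<open>0 \<le> y\<close> by (intro divide_left_mono) auto
      also have "\<dots> = 2 * y" by simp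
      finally show "log 2 (1 + y) \<le> 2 * (real n / (16 * r\<^sup>2) - 1) powr (-3/4)" using y by linarith
      show "0 \<le> real n / (real m)\<^sup>2 + log 2 (1 + y)" using \<open>0 \<le> y\<close> by (simp add: add_nonneg_nonneg)
    qed simp
    also have "\<dots> = (r / (r - 2) + 2 * sqrt n * (n / (real n / (4 * r) - 1)\<^sup>2 + 2 * (real n / (16 * r\<^sup>2) - 1) powr (-3/4))) * N"
      by (simp add: algebra_simps)
    finally show ?case
      unfolding N_def[symmetric] using \<open>0 < N\<close> by (simp only: pos_divide_le_eq of_nat_0_less_iff)
  qed
qed

lemma log_num_union_free_ratio_tendsto:
  "(\<lambda>n. log 2 (num_union_free n) / (n choose (n div 2))) \<longlonglongrightarrow> 1"
proof (rule order_tendstoI)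
  fix a :: real assume "a < 1"
  have "1 \<le> log 2 (num_union_free n) / (n choose (n div 2))" for n
  proof -
    have "real (n choose (n div 2)) = log 2 (2 ^ (n choose (n div 2)))" by simp
    also have "\<dots> \<le> log 2 (num_union_free n)"
      using of_nat_mono[OF num_union_free_ge[of n], where ?'a = real] by (intro log_mono) auto
    finally show ?thesis by (simp add: le_divide_eq)
  qed
  then show "\<forall>\<^sub>F n in sequentially. a < log 2 (num_union_free n) / (n choose (n div 2))"
    using \<open>a < 1\<close> by (intro always_eventually allI) (rule less_le_trans)
next
  fix a :: real assume a: "1 < a"
  \<comment> \<open>First \<open>r\<close> is fixed so that the main term is below \<open>a\<close>;
    then \<open>n\<close> grows, and the error terms are of orders \<open>n powr (-1/2)\<close> and
    \<open>n powr (-1/4)\<close>.\<close>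
  have "(\<lambda>r::nat. r / (real r - 2)) \<longlonglongrightarrow> 1" by real_asymp
  then have "\<forall>\<^sub>F r::nat in sequentially. r / (real r - 2) < a" using a by (rule order_tendstoD)
  then have "\<forall>\<^sub>F r::nat in sequentially. r / (real r - 2) < a \<and> 3 \<le> r"
    using eventually_ge_at_top by (rule eventually_conj)
  from eventually_happens'[OF sequentially_bot this]
  obtain r :: nat where r: "r / (real r - 2) < a" "3 \<le> r" by blast
  define c where "c = real r"
  have c: "c > 0" using r by (simp add: c_def)
  have "(\<lambda>n::nat. c / (c - 2) + 2 * sqrt n * (n / (n / (4 * c) - 1)\<^sup>2 + 2 * (n / (16 * c\<^sup>2) - 1) powr (-3/4)))
      \<longlonglongrightarrow> c / (c - 2)"
    using c by real_asymp
  then have "\<forall>\<^sub>F n::nat in sequentially. c / (c - 2) + 2 * sqrt n * (n / (n / (4 * c) - 1)\<^sup>2 + 2 * (n / (16 * c\<^sup>2) - 1) powr (-3/4)) < a"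
    using r by (intro order_tendstoD) (auto simp: c_def)
  with log_num_union_free_eventually_le[OF r(2)]
  show "\<forall>\<^sub>F n in sequentially. log 2 (num_union_free n) / (n choose (n div 2)) < a"
    by eventually_elim (use r in \<open>auto simp: c_def of_nat_diff\<close>)
qed

theorem theorem3:
  shows "\<exists>\<epsilon> :: nat \<Rightarrow> real. \<epsilon> \<in> o(\<lambda>_. 1) \<and>
           (\<forall>n\<ge>1. real (num_union_free n) = 2 powr (real (n choose (n div 2)) * (1 + \<epsilon> n)))"
proof (intro exI conjI allI impI)
  \<comment> \<open>Obtained by solving the required identity for the error term, so the identity is
    exact and only the limit carries content.\<close>
  let ?\<epsilon> = "\<lambda>n. log 2 (num_union_free n) / (n choose (n div 2)) - 1"
  have "?\<epsilon> \<longlonglongrightarrow> 1 - 1"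
    by (intro tendsto_diff log_num_union_free_ratio_tendsto tendsto_const)
  then show "?\<epsilon> \<in> o(\<lambda>_. 1)" by (intro smalloI_tendsto) auto
  fix n :: nat
  have "0 < num_union_free n" using num_union_free_ge[of n] by (rule less_le_trans[rotated]) simp
  moreover have "real (n choose (n div 2)) \<noteq> 0" by simp
  ultimately show "real (num_union_free n) = 2 powr (real (n choose (n div 2)) * (1 + ?\<epsilon> n))" by simp
qed

end
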